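(* Let $A\subseteq\mathbb{N}$ be a $CR$-set in $(\mathbb{N},+)$. Then there exists $k\in\mathbb{N}$ such that $k\mathbb{N}\subseteq (A-A)(A-A)$.
   Context: $\mathbb{N}=\{1,2,3,\dots\}$. A set $A\subseteq \mathbb{N}$ is a combinatorially rich set ($CR$-set) in $(\mathbb{N},+)$ if for each $k\in\mathbb{N}$ there exists $r\in\mathbb{N}$ such that whenever $M=(m_{i,j})$ is an $r\times k$ matrix with entries from $\mathbb{N}$, there exist $a\in \mathbb{N}$ and a nonempty $H\subseteq\{1,\dots,r\}$ such that for each $j\in\{1,\dots,k\}$, $a+\sum_{t\in H}m_{t,j}\in A$. Here $A-A=\{n\in\mathbb{N}: \text{there is } b\in A \text{ with } b+n\in A\}$ (the positive differences of elements of $A$) and, for $X,Y\subseteq \mathbb{N}$, $XY=\{xy:x\in X,\ y\in Y\}$. *)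

theory Defs
  imports Main "HOL-Library.Set_Algebras"
begin

(* The natural numbers start at 1; they are rendered as the
   positive elements of type nat. *)

abbreviation Npos :: "nat set" where
  "Npos \<equiv> {0<..}"

(* An r x k matrix is a function of a row index in {1..r} and a column index in {1..k};
   its values outside these ranges are irrelevant. *)

definition CR_set :: "nat set \<Rightarrow> bool" where
  "CR_set A \<longleftrightarrow> A \<subseteq> Npos \<and>
    (\<forall>k\<in>Npos. \<exists>r\<in>Npos. \<forall>M :: nat \<Rightarrow> nat \<Rightarrow> nat.
      (\<forall>i\<in>{1..r}. \<forall>j\<in>{1..k}. M i j \<in> Npos) \<longrightarrow>
      (\<exists>a\<in>Npos. \<exists>H. H \<noteq> {} \<and> H \<subseteq> {1..r} \<and>
        (\<forall>j\<in>{1..k}. a + (\<Sum>t\<in>H. M t j) \<in> A)))"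

(* The set usually written A - A, which in HOL would be set difference; 0 is excluded. *)

definition pos_differences :: "nat set \<Rightarrow> nat set" where
  "pos_differences A = {n \<in> Npos. \<exists>b\<in>A. b + n \<in> A}"

(* Products of sets X * Y and dilates k *o X are those of Set_Algebras. *)

end

theory Submission
  imports Defs
begin

text \<open>
  Applied to a matrix with constant columns \<open>1, 1 + c\<^sub>1, \<dots>, 1 + c\<^sub>k\<close>, the definition of a CR-set
  gives an \<open>h \<le> r\<close>, with \<open>r\<close> depending only on \<open>k\<close>, such that every \<open>h * c\<^sub>j\<close> is a difference of \<open>A\<close>.
  Let \<open>r\<close> be the bound for one column. Taking the columns \<open>c\<^sub>j = r!/j\<close> for \<open>j \<le> r\<close> yields an \<open>m\<close> for
  which all \<open>m * r!/j\<close> are differences, and the factor \<open>m * r!\<close> works: for each \<open>n\<close> some \<open>h * n\<close> with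
  \<open>h \<le> r\<close> is a difference, and \<open>m * r! * n = (m * r!/h) * (h * n)\<close>.
\<close>

lemma CR_set_common_multiplier:
  fixes k :: nat
  assumes "CR_set A"
  shows "\<exists>r. \<forall>c. (\<forall>j\<in>{1..k}. 0 < c j) \<longrightarrow>
    (\<exists>h\<in>{1..r}. \<forall>j\<in>{1..k}. h * c j \<in> pos_differences A)"
proof -
  have "Suc k \<in> Npos" by simp
  then obtain r where r: "\<And>M :: nat \<Rightarrow> nat \<Rightarrow> nat. \<forall>i\<in>{1..r}. \<forall>j\<in>{1..Suc k}. M i j \<in> Npos \<Longrightarrow>
      \<exists>a\<in>Npos. \<exists>H. H \<noteq> {} \<and> H \<subseteq> {1..r} \<and> (\<forall>j\<in>{1..Suc k}. a + (\<Sum>t\<in>H. M t j) \<in> A)"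
    using assms unfolding CR_set_def by (elim conjE) (drule (1) bspec, blast)
  show ?thesis
  proof (intro exI allI impI)
    fix c :: "nat \<Rightarrow> nat"
    assume c: "\<forall>j\<in>{1..k}. 0 < c j"
    \<comment> \<open>The column of ones yields the common base point \<open>a + card H\<close> in
      \<open>A\<close>; the other column sums exceed it by exactly
      \<open>card H * c j\<close>.\<close>
    define M :: "nat \<Rightarrow> nat \<Rightarrow> nat" where "M = (\<lambda>i j. if j = Suc k then 1 else 1 + c j)"
    have "\<forall>i\<in>{1..r}. \<forall>j\<in>{1..Suc k}. M i j \<in> Npos"
      by (simp add: M_def)
    from r[OF this] obtain a H where H: "H \<noteq> {}" "H \<subseteq> {1..r}"
      and A: "\<And>j. j \<in> {1..Suc k} \<Longrightarrow> a + (\<Sum>t\<in>H. M t j) \<in> A"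
      by blast
    have "finite H" using H(2) finite_subset by blast
    then have card: "card H \<in> {1..r}"
      using H card_mono[OF _ H(2)] by (simp add: Suc_le_eq card_gt_0_iff)
    have "card H * c j \<in> pos_differences A" if j: "j \<in> {1..k}" for j
    proof -
      have "a + card H \<in> A"
        using A[of "Suc k"] by (simp add: M_def)
      moreover have "a + card H + card H * c j \<in> A"
        using A[of j] j by (simp add: M_def algebra_simps)
      ultimately show ?thesis
        using card c j unfolding pos_differences_def by auto
    qed
    with card show "\<exists>h\<in>{1..r}. \<forall>j\<in>{1..k}. h * c j \<in> pos_differences A"
      by blast
  qed
qed

theorem corollary3p10:
  fixes A :: "nat set"
  assumes "CR_set A"
  shows "\<exists>k\<in>Npos. k *o Npos \<subseteq> pos_differences A * pos_differences A"
proof -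
  \<comment> \<open>Here \<open>h\<close> varies with \<open>n\<close> but never exceeds
    \<open>r\<close>; the second instance therefore takes \<open>r\<close> columns, one for each
    possible \<open>h\<close>.\<close>
  obtain r where r: "\<forall>c. (\<forall>j\<in>{1..1}. 0 < c j) \<longrightarrow>
      (\<exists>h\<in>{1..r}. \<forall>j\<in>{1..1::nat}. h * c j \<in> pos_differences A)"
    using CR_set_common_multiplier[OF assms] ..
  obtain s where s: "\<forall>c. (\<forall>j\<in>{1..r}. 0 < c j) \<longrightarrow>
      (\<exists>m\<in>{1..s}. \<forall>j\<in>{1..r}. m * c j \<in> pos_differences A)"
    using CR_set_common_multiplier[OF assms] ..
  have dvd: "j dvd fact r" if "j \<in> {1..r}" for j
    using that by (simp add: dvd_fact)
  have "0 < fact r div j" if "j \<in> {1..r}" for j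
    using dvd[OF that] that by (simp add: dvd_imp_le div_greater_zero_iff)
  with s[rule_format, of "\<lambda>j. fact r div j"] obtain m where m: "m \<in> {1..s}"
    "\<And>j. j \<in> {1..r} \<Longrightarrow> m * (fact r div j) \<in> pos_differences A"
    by blast
  have "m * fact r * n \<in> pos_differences A * pos_differences A" if n: "n \<in> Npos" for n
  proof -
    obtain h where h: "h \<in> {1..r}" "h * n \<in> pos_differences A"
      using r[rule_format, of "\<lambda>_. n"] n by force
    \<comment> \<open>The division is exact since \<open>h \<le> r\<close>, and \<open>m\<close>
      does not depend on \<open>n\<close>.\<close>
    have "m * fact r * n = m * (fact r div h) * (h * n)"
      using dvd[OF h(1)] by (metis dvd_div_mult_self mult.assoc)
    then show ?thesis
      using m(2)[OF h(1)] h(2) by (metis set_times_intro)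
  qed
  then have "(m * fact r) *o Npos \<subseteq> pos_differences A * pos_differences A"
    by (auto simp: elt_set_times_def)
  moreover have "m * fact r \<in> Npos"
    using m(1) by simp
  ultimately show ?thesis by blast
qed

end
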